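(* Let $R$ be a commutative ring with identity containing $\mathbb{Q}$, and let $N\ge 2$ and $d \ge 0$ be integers. Let $p\in R[X_1,\ldots,X_N]$ be homogeneous of degree $d$, written as a polynomial in $X_N$: $$p = p_0 + p_1X_N+\cdots+p_dX_N^d,\qquad p_0,\ldots,p_d\in R[X_1,\ldots,X_{N-1}].$$ Then $p$ is harmonic if and only if $$p_{2k} = (-1)^k\frac{1}{(2k)!}\Delta^k p_0 \quad\text{for all integers } 1\le k\le d/2,$$ $$p_{2k+1} = (-1)^k\frac{1}{(2k+1)!}\Delta^k p_1\quad\text{for all integers } 1\le k\le (d-1)/2.$$
   Context: $\Delta = \partial_1^2+\cdots+\partial_N^2$ is the Laplacian on $R[X_1,\ldots,X_N]$, $\partial_j=\partial/\partial X_j$ (on polynomials not involving $X_N$ it agrees with $\partial_1^2+\cdots+\partial_{N-1}^2$). A polynomial $p$ is harmonic if $\Delta p=0$. *)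

theory Defs
  imports Complex_Main "HOL-Library.Poly_Mapping"
begin

text \<open>
  A monomial is a finitely supported exponent vector and a polynomial a finitely supported
  map from monomials to coefficients; multiplication is the convolution product of
  \<^theory>\<open>HOL-Library.Poly_Mapping\<close>. The type has variables $X_i$ for all natural numbers
  $i$, and $R[X_1,\ldots,X_N]$ is the subring \<open>polys {1..N}\<close>.
\<close>

type_synonym 'a mvpoly = "(nat \<Rightarrow>\<^sub>0 nat) \<Rightarrow>\<^sub>0 'a"

definition Const :: "'a \<Rightarrow> 'a::comm_ring_1 mvpoly" where
  "Const c = Poly_Mapping.single 0 c"

definition X :: "nat \<Rightarrow> 'a::comm_ring_1 mvpoly" where
  "X i = Poly_Mapping.single (Poly_Mapping.single i 1) 1"

definition polys :: "nat set \<Rightarrow> 'a::comm_ring_1 mvpoly set" where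
  "polys V = {p. \<forall>m \<in> Poly_Mapping.keys p. Poly_Mapping.keys m \<subseteq> V}"

definition monom_degree :: "(nat \<Rightarrow>\<^sub>0 nat) \<Rightarrow> nat" where
  "monom_degree m = (\<Sum>i \<in> Poly_Mapping.keys m. Poly_Mapping.lookup m i)"

text \<open>The zero polynomial is homogeneous of every degree.\<close>

definition homogeneous :: "nat \<Rightarrow> 'a::comm_ring_1 mvpoly \<Rightarrow> bool" where
  "homogeneous d p \<longleftrightarrow> (\<forall>m \<in> Poly_Mapping.keys p. monom_degree m = d)"

text \<open>
  If $X_j$ does not occur in \<open>m\<close>, the truncated exponent subtraction is harmless, because the
  factor \<open>lookup m j\<close> is zero.
\<close>

definition partial :: "nat \<Rightarrow> 'a::comm_ring_1 mvpoly \<Rightarrow> 'a mvpoly" where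
  "partial j p = (\<Sum>m \<in> Poly_Mapping.keys p.
     Poly_Mapping.single (m - Poly_Mapping.single j 1)
       (of_nat (Poly_Mapping.lookup m j) * Poly_Mapping.lookup p m))"

definition laplacian :: "nat \<Rightarrow> 'a::comm_ring_1 mvpoly \<Rightarrow> 'a mvpoly" where
  "laplacian N p = (\<Sum>j = 1..N. partial j (partial j p))"

definition harmonic :: "nat \<Rightarrow> 'a::comm_ring_1 mvpoly \<Rightarrow> bool" where
  "harmonic N p \<longleftrightarrow> laplacian N p = 0"

text \<open>
  The coefficient ring is the type \<open>'a\<close>; that it contains the rationals is witnessed by an
  embedding \<open>\<iota>\<close>, through which rational scalars such as $1/(2k)!$ are read in the ring.
\<close>

definition rat_embedding :: "(rat \<Rightarrow> 'a::comm_ring_1) \<Rightarrow> bool" where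
  "rat_embedding \<iota> \<longleftrightarrow> inj \<iota> \<and> \<iota> 1 = 1 \<and>
     (\<forall>x y. \<iota> (x + y) = \<iota> x + \<iota> y) \<and> (\<forall>x y. \<iota> (x * y) = \<iota> x * \<iota> y)"

end

theory Submission
  imports Defs
begin

text \<open>
  Comparing coefficients of \<open>X N ^ k\<close>, harmonicity of \<open>p\<close> is the recurrence
  \<open>laplacian N (q k) + (k + 1) * (k + 2) * q (k + 2) = 0\<close> for all \<open>k\<close>, with \<open>q k = 0\<close>
  for \<open>k > d\<close>. Homogeneity of \<open>p\<close> makes the cases \<open>k = d - 1\<close> and \<open>k = d\<close> automatic, and the
  remaining ones are solved by iteration, separately for even and odd indices.
\<close>

abbreviation (input) lookup where "lookup \<equiv> Poly_Mapping.lookup"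
abbreviation (input) single where "single \<equiv> Poly_Mapping.single"
abbreviation (input) keys where "keys \<equiv> Poly_Mapping.keys"

section \<open>Coefficients of derivatives and of scalar multiples\<close>

text \<open>The summand of \<open>l\<close> contributes to the coefficient at \<open>m\<close> only
  for \<open>l = m + single j 1\<close>. A monomial without X_j may collide with others under the
  truncated subtraction, but its coefficient carries the factor 0.\<close>

lemma lookup_partial:
  "lookup (partial j p) m = of_nat (lookup m j + 1) * lookup p (m + single j 1)"
proof -
  let ?e = "single j (1::nat)"
  let ?c = "of_nat (lookup m j + 1) * lookup p (m + ?e)"
  have shift: "l - ?e = m \<longleftrightarrow> l = m + ?e" if "lookup l j \<noteq> 0" for l
  proof
    assume "l - ?e = m"
    then have "m + ?e = l - ?e + ?e" by simp
    also have "\<dots> = l"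
      using that by (intro poly_mapping_eqI) (auto simp: lookup_add lookup_minus lookup_single when_def)
    finally show "l = m + ?e" ..
  qed simp
  have "lookup (single (l - ?e) (of_nat (lookup l j) * lookup p l)) m = (if l = m + ?e then ?c else 0)" for l
  proof (cases "lookup l j = 0")
    case True
    then have "l \<noteq> m + ?e" by (auto simp: lookup_add)
    with True show ?thesis by simp
  next
    case False
    with shift[of l] show ?thesis by (auto simp: lookup_single when_def lookup_add)
  qed
  then have "lookup (partial j p) m = (\<Sum>l\<in>keys p. if l = m + ?e then ?c else 0)"
    unfolding partial_def lookup_sum by simp
  also have "\<dots> = ?c"
    by (simp add: sum.delta in_keys_iff)
  finally show ?thesis .
qed

lemma lookup_laplacian:
  "lookup (laplacian N p) m =
     (\<Sum>j = 1..N. of_nat ((lookup m j + 1) * (lookup m j + 2)) * lookup p (m + single j 2))"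
proof -
  have "lookup (partial j (partial j p)) m =
      of_nat ((lookup m j + 1) * (lookup m j + 2)) * lookup p (m + single j 2)" for j
  proof -
    have "m + single j 1 + single j 1 = m + single j 2"
      by (simp add: add.assoc numeral_2_eq_2 flip: single_add)
    then show ?thesis
      by (simp add: lookup_partial lookup_add algebra_simps)
  qed
  then show ?thesis
    by (simp only: laplacian_def lookup_sum)
qed

lemma lookup_Const_times: "lookup (Const c * p) m = c * lookup p m"
  by (simp add: Const_def mult_map_scale_conv_mult[symmetric] map.rep_eq when_def)

lemma of_nat_eq_Const: "of_nat n = Const (of_nat n)"
  by (simp add: Const_def)

lemma lookup_of_nat_times: "lookup (of_nat n * p) m = of_nat n * lookup p m"
  for p :: "'a::comm_ring_1 mvpoly"
  by (simp only: of_nat_eq_Const lookup_Const_times)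

lemma laplacian_Const_times: "laplacian N (Const c * p) = Const c * laplacian N p"
  by (rule poly_mapping_eqI)
    (simp add: lookup_laplacian lookup_Const_times sum_distrib_left mult.left_commute)

section \<open>Expansion in powers of one variable\<close>

text \<open>At most one summand is nonzero. Keeping the sum avoids a case distinction on whether
  \<open>t\<close> divides \<open>m\<close>.\<close>

lemma lookup_times_single:
  "lookup (p * single t c) m = (\<Sum>l\<in>keys p. lookup p l * c when m = l + t)"
  for c :: "'a::comm_ring_1" and p :: "'a mvpoly"
proof -
  have inner: "Sum_any (\<lambda>s. lookup (single t c) s when m = l + s) = (c when m = l + t)" for l
  proof -
    have "(\<lambda>s. lookup (single t c) s when m = l + s) = (\<lambda>s. (c when m = l + t) when s = t)"
      by (auto simp: lookup_single when_def)
    then show ?thesis by (simp only: Sum_any_when_equal)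
  qed
  show ?thesis
    unfolding lookup_mult inner
    by (subst Sum_any.expand_superset[of "keys p"]) (auto simp: mult_when in_keys_iff)
qed

lemma X_power: "X i ^ k = single (single i k) (1::'a::comm_ring_1)"
  by (induction k) (simp_all add: X_def mult_single flip: single_add)

lemma lookup_polys_eq_0:
  assumes "p \<in> polys V" "i \<notin> V" "lookup m i \<noteq> 0"
  shows "lookup p m = 0"
  using assms unfolding polys_def by (force simp only: in_keys_iff mem_Collect_eq subset_iff)

text \<open>Since X_i does not occur in \<open>q j\<close>, every monomial of
  \<open>q j * X i ^ j\<close> has exponent exactly \<open>j\<close> at X_i, so only the summand of
  index \<open>k\<close> can contribute. Beyond \<open>d\<close> the values of \<open>q\<close> are
  arbitrary, hence the explicit 0.\<close>

lemma lookup_expansion: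
  assumes q: "\<forall>k\<le>d. q k \<in> polys V" and "i \<notin> V" and n: "lookup n i = 0"
  shows "lookup (\<Sum>k\<le>d. q k * X i ^ k) (n + single i k) = (if k \<le> d then lookup (q k) n else 0)"
proof -
  have "lookup (q j * X i ^ j) (n + single i k) = (if j = k then lookup (q k) n else 0)"
    if "j \<le> d" for j
  proof -
    have *: "n + single i k = l + single i j \<longleftrightarrow> j = k \<and> l = n" if "l \<in> keys (q j)" for l
    proof
      assume eq: "n + single i k = l + single i j"
      have "lookup l i = 0"
        using lookup_polys_eq_0[OF _ \<open>i \<notin> V\<close>] q \<open>j \<le> d\<close> that by (auto simp: in_keys_iff)
      with arg_cong[OF eq, of "\<lambda>m. lookup m i"] n have "j = k"
        by (simp add: lookup_add)
      with eq show "j = k \<and> l = n" by simp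
    qed simp
    have "lookup (q j * X i ^ j) (n + single i k) =
        (\<Sum>l\<in>keys (q j). if l = n then if j = k then lookup (q k) n else 0 else 0)"
      unfolding X_power lookup_times_single
      by (rule sum.cong) (auto simp: * when_def)
    also have "\<dots> = (if j = k then lookup (q k) n else 0)"
      by (auto simp: sum.delta in_keys_iff)
    finally show ?thesis .
  qed
  then have "lookup (\<Sum>k\<le>d. q k * X i ^ k) (n + single i k) =
      (\<Sum>j\<le>d. if j = k then lookup (q k) n else 0)"
    unfolding lookup_sum by (intro sum.cong) auto
  also have "\<dots> = (if k \<le> d then lookup (q k) n else 0)"
    by (simp add: sum.delta)
  finally show ?thesis .
qed

section \<open>Degrees and homogeneity\<close>

lemma monom_degree_add_single: "monom_degree (m + single j k) = monom_degree m + k"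
proof -
  \<comment> \<open>The supports of \<open>m\<close> and \<open>m + single j k\<close> may differ,
    so both degrees are computed over one common set.\<close>
  have sup: "monom_degree l = (\<Sum>i\<in>insert j (keys m). lookup l i)"
    if "keys l \<subseteq> insert j (keys m)" for l
    unfolding monom_degree_def
    by (rule sum.mono_neutral_left) (use that in \<open>auto simp: in_keys_iff\<close>)
  have "keys (m + single j k) \<subseteq> insert j (keys m)"
    by (auto simp: in_keys_iff lookup_add lookup_single when_def split: if_splits)
  then have "monom_degree (m + single j k) =
      (\<Sum>i\<in>insert j (keys m). lookup m i) + (\<Sum>i\<in>insert j (keys m). if i = j then k else 0)"
    by (subst sup) (auto simp: lookup_add lookup_single when_def sum.distrib intro!: sum.cong)
  also have "\<dots> = monom_degree m + k"
    by (subst sup) (auto simp: sum.delta)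
  finally show ?thesis .
qed

lemma lookup_le_monom_degree: "lookup m i \<le> monom_degree m"
  unfolding monom_degree_def
  by (cases "i \<in> keys m") (auto simp: in_keys_iff intro: member_le_sum)

text \<open>The coefficient at \<open>m\<close> is built from coefficients of \<open>p\<close> in
  degree \<open>monom_degree m + 2\<close>, which exceeds \<open>d\<close> here. This settles the
  powers of X_N from exponent \<open>d - 1\<close> on.\<close>

lemma lookup_laplacian_homogeneous:
  assumes "homogeneous d p" and "d < lookup m i + 2"
  shows "lookup (laplacian N p) m = 0"
proof -
  have "lookup p (m + single j 2) = 0" for j
  proof (rule ccontr)
    assume "lookup p (m + single j 2) \<noteq> 0"
    with assms(1) have "monom_degree (m + single j 2) = d"
      by (simp add: homogeneous_def in_keys_iff)
    with assms(2) lookup_le_monom_degree[of m i] show False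
      by (simp add: monom_degree_add_single)
  qed
  then show ?thesis by (simp add: lookup_laplacian)
qed

section \<open>Harmonicity as a recurrence\<close>

text \<open>At the power \<open>k\<close> of X_N, the second derivative in X_N contributes a
  multiple of \<open>q (k + 2)\<close>, and the other derivatives act on \<open>q k\<close>. In the
  converse, homogeneity takes care of the powers with \<open>k + 2 > d\<close>, on which the
  recurrence is silent.\<close>

lemma harmonic_iff_recurrence:
  assumes "N \<ge> 1"
    and hom: "homogeneous d p"
    and q: "\<forall>k\<le>d. q k \<in> polys {1..N-1}"
    and p: "p = (\<Sum>k\<le>d. q k * X N ^ k)"
  shows "harmonic N p \<longleftrightarrow>
    (\<forall>k. k + 2 \<le> d \<longrightarrow> laplacian N (q k) + of_nat ((k + 1) * (k + 2)) * q (k + 2) = 0)"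
proof -
  have N: "N \<notin> {1..N-1}" and ins: "{1..N} = insert N {1..N-1}"
    using \<open>N \<ge> 1\<close> by auto
  have coeff: "lookup (laplacian N p) (n + single N k) =
      lookup (laplacian N (q k) + of_nat ((k + 1) * (k + 2)) * q (k + 2)) n"
    if n: "lookup n N = 0" and k: "k + 2 \<le> d" for n k
  proof -
    let ?m = "n + single N k"
    have N_term: "lookup p (?m + single N 2) = lookup (q (k + 2)) n"
      using lookup_expansion[OF q N n, of "k + 2"] k
      by (simp add: p add.assoc flip: single_add)
    have "lookup p (?m + single j 2) = lookup (q k) (n + single j 2)" "lookup ?m j = lookup n j"
      if "j \<in> {1..N-1}" for j
    proof -
      have "lookup (n + single j 2) N = 0"
        using n that N by (auto simp: lookup_add lookup_single when_def)
      from lookup_expansion[OF q N this, of k] k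
      show "lookup p (?m + single j 2) = lookup (q k) (n + single j 2)"
        by (simp add: p ac_simps)
      show "lookup ?m j = lookup n j"
        using that N by (auto simp: lookup_add lookup_single when_def)
    qed
    then have "(\<Sum>j = 1..N-1. of_nat ((lookup ?m j + 1) * (lookup ?m j + 2)) * lookup p (?m + single j 2)) =
        (\<Sum>j = 1..N-1. of_nat ((lookup n j + 1) * (lookup n j + 2)) * lookup (q k) (n + single j 2))"
      by (intro sum.cong refl) (simp only:)
    \<comment> \<open>The summand \<open>j = N\<close> of \<open>laplacian N (q k)\<close> vanishes,
      so on \<open>q k\<close> this is the Laplacian in the first \<open>N - 1\<close>
      variables.\<close>
    moreover have "lookup (q k) (n + single N 2) = 0"
      by (rule lookup_polys_eq_0[OF _ N]) (use q k in \<open>auto simp: lookup_add\<close>)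
    moreover have "lookup ?m N = k"
      using n by (simp add: lookup_add)
    ultimately show ?thesis
      using N N_term
      unfolding lookup_add[of "laplacian N (q k)"] lookup_of_nat_times lookup_laplacian ins
      by (simp only: sum.insert finite_atLeastAtMost not_False_eq_True mult_zero_right add_0_left add.commute)
  qed
  show ?thesis
  proof
    assume "harmonic N p"
    then have 0: "laplacian N p = 0" by (simp add: harmonic_def)
    show "\<forall>k. k + 2 \<le> d \<longrightarrow> laplacian N (q k) + of_nat ((k + 1) * (k + 2)) * q (k + 2) = 0"
    proof (intro allI impI poly_mapping_eqI)
      fix k n assume k: "k + 2 \<le> d"
      show "lookup (laplacian N (q k) + of_nat ((k + 1) * (k + 2)) * q (k + 2)) n = lookup 0 n"
      proof (cases "lookup n N = 0")
        case True
        from coeff[OF this k] 0 show ?thesis by simp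
      next
        \<comment> \<open>\<open>coeff\<close> does not cover monomials containing X_N, but neither
          \<open>q (k + 2)\<close> nor \<open>laplacian N (q k)\<close> has any.\<close>
        case False
        then have "lookup (q (k + 2)) n = 0" "lookup (q k) (n + single j 2) = 0" for j
          using q k by (auto intro!: lookup_polys_eq_0[OF _ N] simp: lookup_add)
        then show ?thesis
          unfolding lookup_add[of "laplacian N (q k)"] lookup_of_nat_times lookup_laplacian by simp
      qed
    qed
  next
    assume rec: "\<forall>k. k + 2 \<le> d \<longrightarrow> laplacian N (q k) + of_nat ((k + 1) * (k + 2)) * q (k + 2) = 0"
    have "lookup (laplacian N p) m = 0" for m
    proof (cases "lookup m N + 2 \<le> d")
      case True
      \<comment> \<open>Splitting off the full power of X_N brings \<open>m\<close> into the form
        required by \<open>coeff\<close>.\<close>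
      let ?n = "m - single N (lookup m N)"
      have "lookup ?n N = 0" by (simp add: lookup_minus)
      from coeff[OF this True] rec True have "lookup (laplacian N p) (?n + single N (lookup m N)) = 0"
        by (simp only: lookup_zero)
      moreover have "?n + single N (lookup m N) = m"
        by (intro poly_mapping_eqI) (auto simp: lookup_add lookup_minus lookup_single when_def)
      ultimately show ?thesis by simp
    next
      case False
      then show ?thesis by (intro lookup_laplacian_homogeneous[OF hom, where i = N]) simp
    qed
    then show "harmonic N p"
      unfolding harmonic_def by (intro poly_mapping_eqI) simp
  qed
qed

section \<open>Rational scalars in the coefficient ring\<close>

lemma Const_mult: "Const (a * b) = Const a * Const b"
  by (simp add: Const_def mult_single)

lemma Const_1: "Const 1 = 1"
  by (simp add: Const_def)

text \<open>With the sign read as a constant, the whole scalar of the closed form can be moved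
  through the Laplacian.\<close>

lemma Const_minus_1_power: "(-1) ^ k = Const ((-1) ^ k)"
proof (induction k)
  case (Suc k)
  have "Const (- 1) = (- 1 :: 'a mvpoly)" by (simp add: Const_def single_uminus)
  with Suc show ?case by (simp only: power_Suc Const_mult)
qed (simp add: Const_1)

lemma rat_embedding_of_nat:
  assumes "rat_embedding \<iota>"
  shows "\<iota> (of_nat n) = of_nat n"
proof (induction n)
  case 0
  \<comment> \<open>Additivity forces \<open>\<iota> 0 = 0\<close> by cancellation in the additive
    group.\<close>
  have "\<iota> (0 + 0) = \<iota> 0 + \<iota> 0" using assms unfolding rat_embedding_def by blast
  then show ?case by simp
next
  case (Suc n)
  then show ?case using assms by (simp add: rat_embedding_def)
qed

lemma of_nat_times_Const:
  assumes "rat_embedding \<iota>"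
  shows "of_nat n * Const (\<iota> x) = Const (\<iota> (of_nat n * x))"
  using assms rat_embedding_of_nat[OF assms, of n]
  by (simp add: of_nat_eq_Const rat_embedding_def flip: Const_mult)

section \<open>Solving the recurrence along one parity class\<close>

text \<open>The closed form satisfies the same recurrence and starts at \<open>q e\<close>. Each
  step determines the next term because its integer factor is invertible in a ring containing the
  rationals.\<close>

lemma recurrence_solution:
  fixes \<iota> :: "rat \<Rightarrow> 'a::comm_ring_1" and q :: "nat \<Rightarrow> 'a mvpoly"
  assumes \<iota>: "rat_embedding \<iota>" and e: "e \<le> 1"
  shows "(\<forall>k. 2 * k + e + 2 \<le> d \<longrightarrow>
      laplacian N (q (2 * k + e)) + of_nat ((2 * k + e + 1) * (2 * k + e + 2)) * q (2 * k + e + 2) = 0)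
    \<longleftrightarrow> (\<forall>k. 1 \<le> k \<and> 2 * k + e \<le> d \<longrightarrow>
      q (2 * k + e) = (-1) ^ k * Const (\<iota> (1 / fact (2 * k + e))) * (laplacian N ^^ k) (q e))"
    (is "?rec \<longleftrightarrow> ?sol")
proof -
  define a :: "nat \<Rightarrow> 'a mvpoly" where "a k = (-1) ^ k * Const (\<iota> (1 / fact (2 * k + e)))" for k
  \<comment> \<open>This factor is also the quotient of \<open>fact (2 * k + e + 2)\<close> by
    \<open>fact (2 * k + e)\<close>, which explains the factorials in the solution.\<close>
  define c where "c k = (2 * k + e + 1) * (2 * k + e + 2)" for k
  have c_nonzero: "of_nat (c k) \<noteq> (0::rat)" for k
    unfolding of_nat_eq_0_iff by (simp add: c_def)
  define s where "s k = a k * (laplacian N ^^ k) (q e)" for k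
  \<comment> \<open>Here \<open>e \<le> 1\<close> matters: it makes the closed form start at
    \<open>q e\<close> itself.\<close>
  have "fact e = (1::rat)" using e by (cases e) auto
  then have a0: "a 0 = 1"
    using \<iota> by (simp add: a_def rat_embedding_def Const_1)
  have "of_nat (c k) * Const (\<iota> (1 / fact (2 * Suc k + e))) = Const (\<iota> (1 / fact (2 * k + e)))" for k
  proof -
    have "of_nat (c k) * (1 / fact (2 * Suc k + e)) = (1 / fact (2 * k + e) :: rat)"
    proof -
      have "fact (2 * Suc k + e) = (of_nat (c k) * fact (2 * k + e) :: rat)"
        by (simp add: c_def algebra_simps)
      with c_nonzero[of k] show ?thesis by (simp only: divide_simps fact_nonzero) simp
    qed
    then show ?thesis by (simp only: of_nat_times_Const[OF \<iota>])
  qed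
  then have ac: "of_nat (c k) * a (Suc k) = - a k" for k
    unfolding a_def mult.left_commute[of "of_nat (c k)"] by simp
  have La: "laplacian N (a k * r) = a k * laplacian N r" for k r
    by (simp add: a_def Const_minus_1_power laplacian_Const_times flip: Const_mult)
  have s_step: "laplacian N (s k) + of_nat (c k) * s (Suc k) = 0" for k
    by (simp add: s_def La ac flip: mult.assoc)
  \<comment> \<open>The ring may have zero divisors; cancellation works because the image of
    \<open>1 / of_nat (c k)\<close> is an inverse of \<open>of_nat (c k)\<close>.\<close>
  have cancel: "r = r'" if "of_nat (c k) * r = of_nat (c k) * r'" for k and r r' :: "'a mvpoly"
  proof -
    let ?u = "Const (\<iota> (1 / of_nat (c k)))"
    have "of_nat (c k) * (1 / of_nat (c k)) = (1::rat)" using c_nonzero by simp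
    with \<iota> have "?u * of_nat (c k) = 1"
      unfolding mult.commute[of ?u]
      by (simp only: of_nat_times_Const[OF \<iota>]) (simp add: rat_embedding_def Const_1)
    with arg_cong[OF that, of "\<lambda>r. ?u * r"] show ?thesis
      by (simp flip: mult.assoc)
  qed
  have "?rec \<longleftrightarrow> (\<forall>k. 2 * Suc k + e \<le> d \<longrightarrow>
      laplacian N (q (2 * k + e)) + of_nat (c k) * q (2 * Suc k + e) = 0)"
    by (simp add: c_def add.commute add.left_commute)
  also have "\<dots> \<longleftrightarrow> (\<forall>k. 2 * k + e \<le> d \<longrightarrow> q (2 * k + e) = s k)"
  proof (intro iffI allI impI)
    fix k
    assume rec: "\<forall>k. 2 * Suc k + e \<le> d \<longrightarrow>
        laplacian N (q (2 * k + e)) + of_nat (c k) * q (2 * Suc k + e) = 0"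
    show "2 * k + e \<le> d \<Longrightarrow> q (2 * k + e) = s k"
    proof (induction k)
      case 0
      show ?case by (simp add: s_def a0)
    next
      case (Suc k)
      then have "q (2 * k + e) = s k" by simp
      with rec Suc.prems have "laplacian N (s k) + of_nat (c k) * q (2 * Suc k + e) = 0"
        by metis
      with s_step[of k] have "of_nat (c k) * q (2 * Suc k + e) = of_nat (c k) * s (Suc k)"
        by (metis add_left_cancel)
      then show ?case by (rule cancel)
    qed
  next
    fix k
    assume sol: "\<forall>k. 2 * k + e \<le> d \<longrightarrow> q (2 * k + e) = s k" and k: "2 * Suc k + e \<le> d"
    have "q (2 * k + e) = s k" using sol k by simp
    moreover have "q (2 * Suc k + e) = s (Suc k)" using sol k by blast
    ultimately show "laplacian N (q (2 * k + e)) + of_nat (c k) * q (2 * Suc k + e) = 0"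
      by (simp only: s_step)
  qed
  also have "\<dots> \<longleftrightarrow> ?sol"
  proof -
    \<comment> \<open>The case \<open>k = 0\<close> holds outright, so restricting to
      \<open>1 \<le> k\<close> loses nothing.\<close>
    have "q (2 * 0 + e) = s 0" by (simp add: s_def a0)
    then have "(\<forall>k. 2 * k + e \<le> d \<longrightarrow> q (2 * k + e) = s k) \<longleftrightarrow>
        (\<forall>k. 1 \<le> k \<and> 2 * k + e \<le> d \<longrightarrow> q (2 * k + e) = s k)"
      by (metis One_nat_def Suc_leI not_gr0)
    then show ?thesis by (simp only: s_def a_def)
  qed
  finally show ?thesis .
qed

theorem proposition2p12:
  fixes \<iota> :: "rat \<Rightarrow> 'a::comm_ring_1"
    and N d :: nat
    and p :: "'a mvpoly"
    and q :: "nat \<Rightarrow> 'a mvpoly"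
  assumes "rat_embedding \<iota>"
    and "N \<ge> 2"
    and "p \<in> polys {1..N}"
    and "homogeneous d p"
    and "\<forall>k\<le>d. q k \<in> polys {1..N-1}"
    and "p = (\<Sum>k\<le>d. q k * X N ^ k)"
  shows "harmonic N p \<longleftrightarrow>
    (\<forall>k. 1 \<le> k \<and> 2 * k \<le> d \<longrightarrow>
       q (2 * k) = (-1) ^ k * Const (\<iota> (1 / fact (2 * k))) * (laplacian N ^^ k) (q 0)) \<and>
    (\<forall>k. 1 \<le> k \<and> 2 * k + 1 \<le> d \<longrightarrow>
       q (2 * k + 1) = (-1) ^ k * Const (\<iota> (1 / fact (2 * k + 1))) * (laplacian N ^^ k) (q 1))"
proof -
  \<comment> \<open>The recurrence links only indices of equal parity, so it splits into two
    independent chains starting at \<open>q 0\<close> and \<open>q 1\<close>.\<close>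
  have parity: "(\<forall>k. P k) \<longleftrightarrow> (\<forall>k. P (2 * k + 0)) \<and> (\<forall>k. P (2 * k + 1))" for P :: "nat \<Rightarrow> bool"
    by (metis add_0_right evenE oddE)
  have "N \<ge> 1" using assms(2) by simp
  show ?thesis
    unfolding harmonic_iff_recurrence[OF \<open>N \<ge> 1\<close> assms(4-6)]
    by (subst parity)
      (simp only: recurrence_solution[OF assms(1) zero_le, simplified add_0_right]
        recurrence_solution[OF assms(1) le_refl] add_0_right)
qed

end
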